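(* Let $A$ be an evolution $\mathbb{K}$-algebra with natural basis $B$ and associated directed graph $E$ relative to $B$, and let $\mathcal{H}$ be the set of hereditary subsets of $E^0=B$. Then: (1) Let $I$ be an ideal of $A$ with $A^2\subset I$. Then $I$ is a maximal ideal of $A$ if and only if $I$ is a subspace of codimension $1$. (2) If $I$ is a maximal ideal of $A$ with $A^2\not\subset I$, then $I=I_{H_I}$. (3) Let $H\in\mathcal{H}$. If $I_H$ is a maximal ideal, then $H$ is a maximal element of $\mathcal{H}$. Conversely, if $H$ is maximal in $\mathcal{H}$ and $I_H$ is not contained in any subspace $S$ with $A^2\subset S\subsetneq A$, then $I_H$ is a maximal ideal.
   Context: An evolution algebra over a field $\mathbb{K}$ is a (not necessarily associative or finite-dimensional) $\mathbb{K}$-algebra $A$ having a basis $B=\{e_i\}_{i\in\Lambda}$, called a natural basis, with $e_ie_j=0$ whenever $i\neq j$. $A^2$ is the linear span of all products. The associated directed graph $E$ relative to $B$ has vertex set $E^0=B$ and exactly one edge from $e_i$ to $e_j$ if the coefficient of $e_j$ in $e_i^2$ is nonzero, and no edge otherwise. A subset $H\subset E^0$ is hereditary if, for every $u\in H$, every vertex reachable from $u$ by a directed path belongs to $H$. A hereditary set $H\neq E^0$ is maximal (in $\mathcal{H}$) if whenever $H\subset H'$ with $H'$ hereditary, then $H'=H$ or $H'=E^0$. For an ideal $I$ of $A$, $H_I:=\{e_i\in B: e_i^2\in I\}$ (a hereditary set). For a hereditary $H$, $I_H:=\operatorname{span}(H)$ (an ideal of $A$), with $I_\emptyset=\{0\}$.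 *)

theory Defs
  imports Main "Graph_Theory.Pair_Digraph"
begin

text \<open>
  \<open>I\<close> has codimension \<open>n\<close> if the quotient space by \<open>I\<close> has a basis of \<open>n\<close> elements. Such a basis
  is given here by a set \<open>C\<close> of representatives of its cosets: linear independence and spanning are
  read modulo \<open>I\<close>. Independence modulo \<open>I\<close> also makes the cosets of distinct elements of \<open>C\<close>
  distinct.
\<close>

definition (in vector_space) has_codim :: "'b set \<Rightarrow> nat \<Rightarrow> bool" where
  "has_codim I n \<longleftrightarrow> subspace I \<and>
     (\<exists>C. finite C \<and> card C = n \<and>
        (\<forall>a. (\<Sum>c\<in>C. a c *s c) \<in> I \<longrightarrow> (\<forall>c\<in>C. a c = 0)) \<and>
        (\<forall>x. \<exists>y\<in>span C. x - y \<in> I))"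

text \<open>
  Agreement with the dimension of the quotient, for any model of the quotient as a surjective
  linear map with kernel \<open>I\<close>.
\<close>

lemma has_codim_iff_dim_quotient:
  fixes scaleV :: "'k::field \<Rightarrow> 'v::ab_group_add \<Rightarrow> 'v"
    and scaleW :: "'k \<Rightarrow> 'w::ab_group_add \<Rightarrow> 'w"
  assumes lin: "Vector_Spaces.linear scaleV scaleW f" and surj: "surj f"
    and ker: "{x. f x = 0} = I"
  shows "vector_space.has_codim scaleV I n \<longleftrightarrow>
    (\<exists>D. finite D \<and> card D = n \<and> \<not> module.dependent scaleW D \<and> module.span scaleW D = UNIV)"
proof -
  interpret f: Vector_Spaces.linear scaleV scaleW f by (fact lin)
  have kerD: "x \<in> I \<longleftrightarrow> f x = 0" for x using ker by auto
  have sub: "f.vs1.subspace I"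
    unfolding f.vs1.subspace_def by (auto simp: kerD f.zero f.add f.scale)
  have key: "(\<forall>a. (\<Sum>c\<in>C. scaleV (a c) c) \<in> I \<longrightarrow> (\<forall>c\<in>C. a c = 0)) \<longleftrightarrow>
      inj_on f C \<and> \<not> f.vs2.dependent (f ` C)" (is "?L \<longleftrightarrow> ?R") if fin: "finite C" for C
  proof
    assume L: ?L
    have inj: "inj_on f C"
    proof (rule inj_onI, rule ccontr)
      fix c d assume cd: "c \<in> C" "d \<in> C" "f c = f d" "c \<noteq> d"
      let ?a = "\<lambda>x. if x = c then 1 else if x = d then - 1 else (0::'k)"
      have "(\<Sum>x\<in>C. scaleV (?a x) x) = (\<Sum>x\<in>{c,d}. scaleV (?a x) x)"
        by (rule sum.mono_neutral_right) (use cd fin in auto)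
      also have "\<dots> = c - d" using cd by simp
      finally have "(\<Sum>x\<in>C. scaleV (?a x) x) \<in> I" using cd by (simp add: kerD f.diff)
      then have "?a c = 0" by (rule L[rule_format, of ?a, OF _ cd(1)])
      then show False by simp
    qed
    have "b v = 0" if b: "(\<Sum>v\<in>f ` C. scaleW (b v) v) = 0" and v: "v \<in> f ` C" for b v
    proof -
      have "f (\<Sum>c\<in>C. scaleV (b (f c)) c) = (\<Sum>v\<in>f ` C. scaleW (b v) v)"
        by (simp add: f.sum f.scale sum.reindex[OF inj])
      then have "(\<Sum>c\<in>C. scaleV (b (f c)) c) \<in> I" using b by (simp add: kerD)
      then have "\<forall>c\<in>C. b (f c) = 0" using L[rule_format, of "\<lambda>c. b (f c)"] by blast
      then show ?thesis using v by auto
    qed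
    then show ?R using inj fin unfolding f.vs2.dependent_finite[OF finite_imageI[OF fin]] by blast
  next
    assume R: ?R
    show ?L
    proof (intro allI impI)
      fix a assume "(\<Sum>c\<in>C. scaleV (a c) c) \<in> I"
      then have "0 = f (\<Sum>c\<in>C. scaleV (a c) c)" by (simp add: kerD)
      also have "\<dots> = (\<Sum>c\<in>C. scaleW (a c) (f c))" by (simp add: f.sum f.scale)
      also have "\<dots> = (\<Sum>c\<in>C. scaleW (a (inv_into C f (f c))) (f c))"
        by (rule sum.cong) (use R in auto)
      also have "\<dots> = (\<Sum>v\<in>f ` C. scaleW (a (inv_into C f v)) v)"
        using R by (simp add: sum.reindex)
      finally have "(\<Sum>v\<in>f ` C. scaleW (a (inv_into C f v)) v) = 0" by simp
      then have "a (inv_into C f v) = 0" if "v \<in> f ` C" for v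
        using R f.vs2.independentD[of "f ` C" "f ` C" "\<lambda>v. a (inv_into C f v)" v] fin that
        by simp
      then have "a (inv_into C f (f c)) = 0" if "c \<in> C" for c using that by blast
      then show "\<forall>c\<in>C. a c = 0" using R by simp
    qed
  qed
  have span: "(\<forall>x. \<exists>y\<in>f.vs1.span C. x - y \<in> I) \<longleftrightarrow> f.vs2.span (f ` C) = UNIV" for C
  proof -
    have "(\<forall>x. \<exists>y\<in>f.vs1.span C. x - y \<in> I) \<longleftrightarrow> (\<forall>x. f x \<in> f ` f.vs1.span C)"
      by (simp add: kerD f.diff image_iff)
    also have "\<dots> \<longleftrightarrow> (\<forall>w. w \<in> f ` f.vs1.span C)" using surj by (metis surjD)
    finally show ?thesis by (auto simp: f.span_image)
  qed
  have codim: "f.vs1.has_codim I n \<longleftrightarrow> (\<exists>C. finite C \<and> card C = n \<and>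
      (inj_on f C \<and> \<not> f.vs2.dependent (f ` C)) \<and> f.vs2.span (f ` C) = UNIV)"
    unfolding f.vs1.has_codim_def span by (simp add: sub key cong: conj_cong)
  show ?thesis
  proof
    assume "f.vs1.has_codim I n"
    then obtain C where "finite C" "card C = n" "inj_on f C" "\<not> f.vs2.dependent (f ` C)"
      "f.vs2.span (f ` C) = UNIV"
      unfolding codim by blast
    then show "\<exists>D. finite D \<and> card D = n \<and> \<not> f.vs2.dependent D \<and> f.vs2.span D = UNIV"
      by (intro exI[of _ "f ` C"]) (auto simp: card_image)
  next
    assume "\<exists>D. finite D \<and> card D = n \<and> \<not> f.vs2.dependent D \<and> f.vs2.span D = UNIV"
    then obtain D where D: "finite D" "card D = n" "\<not> f.vs2.dependent D" "f.vs2.span D = UNIV"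
      by blast
    define C where "C = inv f ` D"
    have fC: "f ` C = D" unfolding C_def using surj by (simp add: image_f_inv_f)
    have inj: "inj_on f C" unfolding C_def using surj by (auto simp: inj_on_def surj_f_inv_f)
    have fin: "finite C" and card: "card C = n"
      using D fC inj card_image[of f C] by (auto simp: C_def)
    show "f.vs1.has_codim I n"
      unfolding codim by (intro exI[of _ C]) (simp add: fin card inj fC D)
  qed
qed

locale nonassoc_algebra = vector_space scale
  for scale :: "'k::field \<Rightarrow> 'a::ab_group_add \<Rightarrow> 'a" +
  fixes mult :: "'a \<Rightarrow> 'a \<Rightarrow> 'a"
  assumes linear_mult_right: "Vector_Spaces.linear scale scale (\<lambda>y. mult x y)"
    and linear_mult_left: "Vector_Spaces.linear scale scale (\<lambda>x. mult x y)"
begin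

definition square :: "'a set" where
  "square = span {mult x y | x y. True}"

definition ideal :: "'a set \<Rightarrow> bool" where
  "ideal I \<longleftrightarrow> subspace I \<and> (\<forall>x. \<forall>y\<in>I. mult x y \<in> I \<and> mult y x \<in> I)"

definition maximal_ideal :: "'a set \<Rightarrow> bool" where
  "maximal_ideal I \<longleftrightarrow> ideal I \<and> I \<noteq> UNIV \<and>
     (\<forall>J. ideal J \<longrightarrow> I \<subseteq> J \<longrightarrow> J = I \<or> J = UNIV)"

end

locale evolution_algebra = nonassoc_algebra scale mult
  for scale :: "'k::field \<Rightarrow> 'a::ab_group_add \<Rightarrow> 'a" and mult :: "'a \<Rightarrow> 'a \<Rightarrow> 'a" +
  fixes B :: "'a set"
  assumes independent_B: "independent B"
    and span_B: "span B = UNIV"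
    and mult_distinct: "\<lbrakk>u \<in> B; v \<in> B; u \<noteq> v\<rbrakk> \<Longrightarrow> mult u v = 0"
begin

definition assoc_graph :: "'a pair_pre_digraph" where
  "assoc_graph = \<lparr> pverts = B,
     parcs = {(u, v). u \<in> B \<and> v \<in> B \<and> representation B (mult u u) v \<noteq> 0} \<rparr>"

definition vertices_of_ideal :: "'a set \<Rightarrow> 'a set" where
  "vertices_of_ideal I = {u \<in> B. mult u u \<in> I}"

definition ideal_of_vertices :: "'a set \<Rightarrow> 'a set" where
  "ideal_of_vertices H = span H"

end

definition hereditary :: "'v pair_pre_digraph \<Rightarrow> 'v set \<Rightarrow> bool" where
  "hereditary G H \<longleftrightarrow> H \<subseteq> pverts G \<and>
     (\<forall>u\<in>H. \<forall>v. u \<rightarrow>\<^sup>*\<^bsub>with_proj G\<^esub> v \<longrightarrow> v \<in> H)"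

definition maximal_hereditary :: "'v pair_pre_digraph \<Rightarrow> 'v set \<Rightarrow> bool" where
  "maximal_hereditary G H \<longleftrightarrow> hereditary G H \<and> H \<noteq> pverts G \<and>
     (\<forall>H'. hereditary G H' \<longrightarrow> H \<subseteq> H' \<longrightarrow> H' = H \<or> H' = pverts G)"

end

theory Submission
  imports Defs
begin

text \<open>
  In an evolution algebra a product with a natural basis vector \<open>u\<close> sees only one coordinate:
  \<open>x u = u x = x\<^sub>u u\<^sup>2\<close>. Multiplying an element \<open>y\<close> of an ideal \<open>I\<close> by the vectors in its support
  therefore puts all their squares into \<open>I\<close>, and conversely the products of \<open>y\<close> are combinations
  of these squares. So the ideals are exactly the subspaces \<open>I\<close> with \<open>I \<subseteq> span H\<^sub>I\<close>
  (\<open>ideal_iff_subset_span_vertices\<close>). Since the out-neighbours of \<open>u\<close> form the support of \<open>u\<^sup>2\<close>,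
  the hereditary sets are exactly the sets \<open>H\<close> of vertices for which \<open>span H\<close> is an ideal
  (\<open>ideal_span_iff_hereditary\<close>), and \<open>H\<^sub>I\<close> is one of them.

  Hence a maximal ideal \<open>I\<close> lies in the ideal \<open>span H\<^sub>I\<close>, which is either \<open>I\<close> or everything; in
  the latter case all squares of basis vectors lie in \<open>I\<close>, so \<open>A\<^sup>2 \<subseteq> I\<close>, which
  the second part excludes. The same dichotomy,
  applied to an ideal above \<open>span H\<close>, gives the converse half of the third part, while the direct
  half holds because \<open>span\<close> is an order embedding on subsets of the basis. When \<open>A\<^sup>2 \<subseteq> I\<close>, every
  subspace above \<open>I\<close> is an ideal, and the first part is the linear algebra of hyperplanes
  (\<open>has_codim_1_iff_maximal_subspace\<close>).
\<close>

section \<open>Subspaces of codimension one\<close>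

lemma (in vector_space) has_codim_1_iff:
  "has_codim I 1 \<longleftrightarrow> subspace I \<and> (\<exists>c. c \<notin> I \<and> (\<forall>x. \<exists>k. x - k *s c \<in> I))"
proof (cases "subspace I")
  case True
  have indep: "(\<forall>a. a c *s c \<in> I \<longrightarrow> a c = 0) \<longleftrightarrow> c \<notin> I" for c
  proof
    assume *: "\<forall>a. a c *s c \<in> I \<longrightarrow> a c = 0"
    show "c \<notin> I" using *[rule_format, of "\<lambda>_. 1"] by auto
  next
    assume c: "c \<notin> I"
    show "\<forall>a. a c *s c \<in> I \<longrightarrow> a c = 0"
    proof (intro allI impI, rule ccontr)
      fix a assume "a c *s c \<in> I" "a c \<noteq> 0"
      then have "inverse (a c) *s (a c *s c) \<in> I" using True subspace_scale by blast
      then show False using c \<open>a c \<noteq> 0\<close> by simp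
    qed
  qed
  have singleton: "(\<exists>C. finite C \<and> card C = 1 \<and> P C) \<longleftrightarrow> (\<exists>c. P {c})" for P :: "'b set \<Rightarrow> bool"
    unfolding card_1_singleton_iff One_nat_def by blast
  have "has_codim I 1 \<longleftrightarrow> (\<exists>c. (\<forall>a. a c *s c \<in> I \<longrightarrow> a c = 0) \<and>
      (\<forall>x. \<exists>y\<in>span {c}. x - y \<in> I))"
    unfolding has_codim_def singleton using True by simp
  then show ?thesis using True by (simp add: indep span_singleton)
qed (simp add: has_codim_def)

text \<open>
  A subspace strictly above \<open>I\<close> contains some \<open>c \<notin> I\<close>, hence all of \<open>I + \<langle>c\<rangle>\<close>, which is the
  whole space in codimension 1. Conversely, if \<open>I\<close> is maximal among the proper subspaces, \<open>I + \<langle>c\<rangle>\<close> is the whole space for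
  any \<open>c \<notin> I\<close>.
\<close>

lemma (in vector_space) has_codim_1_iff_maximal_subspace:
  "has_codim I 1 \<longleftrightarrow>
     subspace I \<and> I \<noteq> UNIV \<and> (\<forall>J. subspace J \<longrightarrow> I \<subseteq> J \<longrightarrow> J = I \<or> J = UNIV)"
  (is "?L \<longleftrightarrow> ?R")
proof
  assume ?L
  then obtain c where I: "subspace I" and c: "c \<notin> I" and x: "\<And>x. \<exists>k. x - k *s c \<in> I"
    unfolding has_codim_1_iff by blast
  have "J = UNIV" if J: "subspace J" "I \<subseteq> J" "J \<noteq> I" for J
  proof -
    obtain d where d: "d \<in> J" "d \<notin> I" using J by blast
    obtain k where k: "d - k *s c \<in> I" using x by blast
    have "k \<noteq> 0" using k d by auto
    have "d - (d - k *s c) \<in> J" using d k J subspace_diff by blast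
    then have "inverse k *s (k *s c) \<in> J" using J subspace_scale by fastforce
    then have cJ: "c \<in> J" using \<open>k \<noteq> 0\<close> by simp
    have "y \<in> J" for y
    proof -
      obtain l where "y - l *s c \<in> I" using x by blast
      then have "(y - l *s c) + l *s c \<in> J"
        using cJ J by (intro subspace_add subspace_scale) auto
      then show ?thesis by simp
    qed
    then show ?thesis by blast
  qed
  then show ?R using I c by blast
next
  assume R: ?R
  then obtain c where c: "c \<notin> I" by blast
  have "span (insert c I) = UNIV"
    using R[THEN conjunct2, THEN conjunct2, rule_format, of "span (insert c I)"] c
    by (metis insertI1 order_trans span_superset subset_insertI subspace_span subsetD)
  then have "\<exists>k. x - k *s c \<in> I" for x
    using R span_breakdown_eq[of x c I] by (auto simp: span_eq_iff[THEN iffD2])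
  then show ?L using R c unfolding has_codim_1_iff by blast
qed

section \<open>Ideals containing all products\<close>

context nonassoc_algebra
begin

lemma ideal_if_square_subset:
  assumes "subspace J" "square \<subseteq> J"
  shows "ideal J"
  using assms unfolding ideal_def square_def by (auto intro: span_base)

lemma maximal_ideal_iff_has_codim_1:
  assumes I: "ideal I" and sq: "square \<subseteq> I"
  shows "maximal_ideal I \<longleftrightarrow> has_codim I 1"
proof -
  have "ideal J \<longleftrightarrow> subspace J" if "I \<subseteq> J" for J
    using that sq ideal_if_square_subset[of J] by (auto simp: ideal_def)
  then show ?thesis
    using I unfolding maximal_ideal_def has_codim_1_iff_maximal_subspace by blast
qed

end

section \<open>Ideals through the supports of their elements\<close>

context evolution_algebra
begin

lemma pverts_assoc_graph: "pverts assoc_graph = B"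
  by (simp add: assoc_graph_def)

text \<open>Expand \<open>x\<close> in \<open>B\<close>: every basis vector other than \<open>u\<close> annihilates \<open>u\<close>.\<close>

lemma mult_basis_eq:
  assumes u: "u \<in> B"
  shows "mult x u = scale (representation B x u) (mult u u)"
    and "mult u x = scale (representation B x u) (mult u u)"
proof -
  interpret L: Vector_Spaces.linear scale scale "\<lambda>y. mult y u" by (fact linear_mult_left)
  interpret R: Vector_Spaces.linear scale scale "\<lambda>y. mult u y" by (fact linear_mult_right)
  let ?r = "representation B x"
  let ?S = "insert u {b. ?r b \<noteq> 0}"
  have fin: "finite ?S" by (simp add: finite_representation)
  have SB: "?S \<subseteq> B" using u representation_ne_zero by auto
  have zero: "mult b u = 0 \<and> mult u b = 0" if "b \<in> ?S - {u}" for b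
    using that SB u mult_distinct by blast
  have "x = (\<Sum>b | ?r b \<noteq> 0. scale (?r b) b)"
    using span_B independent_B by (simp add: sum_nonzero_representation_eq)
  also have "\<dots> = (\<Sum>b\<in>?S. scale (?r b) b)"
    using fin by (intro sum.mono_neutral_left) auto
  finally have x: "x = (\<Sum>b\<in>?S. scale (?r b) b)" .
  have "mult x u = (\<Sum>b\<in>?S. scale (?r b) (mult b u))" by (subst x) (simp add: L.sum L.scale)
  also have "\<dots> = (\<Sum>b\<in>{u}. scale (?r b) (mult b u))"
    using fin zero by (intro sum.mono_neutral_right) auto
  finally show "mult x u = scale (?r u) (mult u u)" by simp
  have "mult u x = (\<Sum>b\<in>?S. scale (?r b) (mult u b))" by (subst x) (simp add: R.sum R.scale)
  also have "\<dots> = (\<Sum>b\<in>{u}. scale (?r b) (mult u b))"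
    using fin zero by (intro sum.mono_neutral_right) auto
  finally show "mult u x = scale (?r u) (mult u u)" by simp
qed

lemma span_iff_support:
  assumes "C \<subseteq> B"
  shows "x \<in> span C \<longleftrightarrow> (\<forall>u. representation B x u \<noteq> 0 \<longrightarrow> u \<in> C)"
proof
  assume "x \<in> span C"
  then have "representation B x = representation C x"
    using assms independent_B by (intro representation_extend)
  then show "\<forall>u. representation B x u \<noteq> 0 \<longrightarrow> u \<in> C" by (simp add: representation_ne_zero)
next
  assume *: "\<forall>u. representation B x u \<noteq> 0 \<longrightarrow> u \<in> C"
  have "(\<Sum>u | representation B x u \<noteq> 0. scale (representation B x u) u) \<in> span C"
    using * by (intro span_sum span_scale span_base) auto
  then show "x \<in> span C" using span_B independent_B by (simp add: sum_nonzero_representation_eq)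
qed

lemma span_subset_span_iff:
  assumes "C \<subseteq> B" "D \<subseteq> B"
  shows "span C \<subseteq> span D \<longleftrightarrow> C \<subseteq> D"
proof
  assume sub: "span C \<subseteq> span D"
  show "C \<subseteq> D"
  proof
    fix u assume u: "u \<in> C"
    then have "u \<in> span D" using sub span_base by blast
    moreover have "representation B u u \<noteq> 0"
      using u assms independent_B by (simp add: representation_basis subset_iff)
    ultimately show "u \<in> D" using assms span_iff_support by blast
  qed
qed (rule span_mono)

lemma span_eq_UNIV_iff:
  assumes "C \<subseteq> B"
  shows "span C = UNIV \<longleftrightarrow> C = B"
  using span_subset_span_iff[OF order_refl assms] assms span_B by auto

lemma square_subset_iff:
  assumes "subspace J"
  shows "square \<subseteq> J \<longleftrightarrow> vertices_of_ideal J = B"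
proof
  assume "square \<subseteq> J"
  then show "vertices_of_ideal J = B"
    unfolding vertices_of_ideal_def square_def by (auto intro: span_base)
next
  assume V: "vertices_of_ideal J = B"
  have "mult x y \<in> J" for x y
  proof -
    interpret R: Vector_Spaces.linear scale scale "\<lambda>y. mult x y" by (fact linear_mult_right)
    have "y \<in> span B" using span_B by simp
    then show ?thesis
    proof (induction rule: span_induct_alt)
      case base
      show ?case using assms by (simp add: R.zero subspace_0)
    next
      case (step k u z)
      then have "mult u u \<in> J" using V by (auto simp: vertices_of_ideal_def)
      then have "mult x u \<in> J"
        using step assms by (simp add: mult_basis_eq[of u x] subspace_scale)
      then show ?case using step assms by (simp add: R.add R.scale subspace_add subspace_scale)
    qed
  qed
  then show "square \<subseteq> J" unfolding square_def using assms by (intro span_minimal) auto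
qed

text \<open>
  The product of \<open>y \<in> I\<close> with \<open>u \<in> B\<close> is \<open>y\<^sub>u u\<^sup>2\<close>, so an ideal contains \<open>u\<^sup>2\<close> as soon as one of its
  elements has \<open>u\<close> in its support. Conversely, for \<open>u \<in> H\<^sub>I\<close> any product with \<open>u\<close> is a multiple of
  \<open>u\<^sup>2 \<in> I\<close>, and this extends linearly to \<open>span H\<^sub>I\<close>.
\<close>

lemma ideal_iff_subset_span_vertices:
  "ideal I \<longleftrightarrow> subspace I \<and> I \<subseteq> span (vertices_of_ideal I)"
proof
  assume I: "ideal I"
  have "u \<in> vertices_of_ideal I" if y: "y \<in> I" and ne: "representation B y u \<noteq> 0" for y u
  proof -
    let ?r = "representation B y u"
    have u: "u \<in> B" using ne by (rule representation_ne_zero)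
    have "scale ?r (mult u u) \<in> I" using I y by (simp add: ideal_def flip: mult_basis_eq(1)[OF u])
    then have "scale (inverse ?r) (scale ?r (mult u u)) \<in> I"
      using I by (simp only: ideal_def subspace_scale)
    then show ?thesis using ne u by (simp add: vertices_of_ideal_def)
  qed
  then have "I \<subseteq> span (vertices_of_ideal I)"
    using span_iff_support[of "vertices_of_ideal I"] by (auto simp: vertices_of_ideal_def)
  then show "subspace I \<and> I \<subseteq> span (vertices_of_ideal I)" using I by (simp add: ideal_def)
next
  assume asm: "subspace I \<and> I \<subseteq> span (vertices_of_ideal I)"
  have "mult x y \<in> I \<and> mult y x \<in> I" if "y \<in> I" for x y
  proof -
    interpret L: Vector_Spaces.linear scale scale "\<lambda>y. mult y x" by (fact linear_mult_left)
    interpret R: Vector_Spaces.linear scale scale "\<lambda>y. mult x y" by (fact linear_mult_right)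
    have "y \<in> span (vertices_of_ideal I)" using that asm by blast
    then show ?thesis
    proof (induction rule: span_induct_alt)
      case base
      show ?case using asm by (simp add: L.zero R.zero subspace_0)
    next
      case (step k u z)
      then have "mult x u \<in> I" "mult u x \<in> I"
        using asm by (simp_all add: mult_basis_eq[of u x] vertices_of_ideal_def subspace_scale)
      then show ?case
        using step asm by (simp add: L.add L.scale R.add R.scale subspace_add subspace_scale)
    qed
  qed
  then show "ideal I" using asm by (simp add: ideal_def)
qed

section \<open>Hereditary sets and ideals\<close>

text \<open>
  Closure under paths reduces to closure under single arcs, and the out-neighbours of \<open>u\<close> lie in
  \<open>H\<close> precisely when the support of \<open>u\<^sup>2\<close> does.
\<close>

lemma hereditary_iff:
  "hereditary assoc_graph H \<longleftrightarrow> H \<subseteq> vertices_of_ideal (span H)"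
proof -
  interpret G: wf_digraph "with_proj assoc_graph"
    by unfold_locales (auto simp: assoc_graph_def)
  have arc: "u \<rightarrow>\<^bsub>with_proj assoc_graph\<^esub> v \<longleftrightarrow> u \<in> B \<and> representation B (mult u u) v \<noteq> 0"
    for u v
    using representation_ne_zero by (auto simp: assoc_graph_def)
  have V: "H \<subseteq> vertices_of_ideal (span H) \<longleftrightarrow>
      H \<subseteq> B \<and> (\<forall>u\<in>H. \<forall>v. u \<rightarrow>\<^bsub>with_proj assoc_graph\<^esub> v \<longrightarrow> v \<in> H)"
  proof (cases "H \<subseteq> B")
    case True
    then show ?thesis
      unfolding arc vertices_of_ideal_def using span_iff_support[OF True] by blast
  qed (auto simp: vertices_of_ideal_def)
  have "hereditary assoc_graph H \<longleftrightarrow>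
      H \<subseteq> B \<and> (\<forall>u\<in>H. \<forall>v. u \<rightarrow>\<^bsub>with_proj assoc_graph\<^esub> v \<longrightarrow> v \<in> H)"
  proof
    assume H: "hereditary assoc_graph H"
    have "v \<in> H" if "u \<in> H" "u \<rightarrow>\<^bsub>with_proj assoc_graph\<^esub> v" for u v
      using that(1) H G.reachable_adjI[OF that(2)] unfolding hereditary_def by blast
    then show "H \<subseteq> B \<and> (\<forall>u\<in>H. \<forall>v. u \<rightarrow>\<^bsub>with_proj assoc_graph\<^esub> v \<longrightarrow> v \<in> H)"
      using H unfolding hereditary_def pverts_assoc_graph by blast
  next
    assume H: "H \<subseteq> B \<and> (\<forall>u\<in>H. \<forall>v. u \<rightarrow>\<^bsub>with_proj assoc_graph\<^esub> v \<longrightarrow> v \<in> H)"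
    have "v \<in> H" if "u \<rightarrow>\<^sup>*\<^bsub>with_proj assoc_graph\<^esub> v" "u \<in> H" for u v
      using that by (induction rule: G.reachable_induct) (use H in blast)+
    then show "hereditary assoc_graph H"
      using H unfolding hereditary_def pverts_assoc_graph by blast
  qed
  with V show ?thesis by simp
qed

lemma ideal_span_iff_hereditary:
  assumes "H \<subseteq> B"
  shows "ideal (span H) \<longleftrightarrow> hereditary assoc_graph H"
  using span_subset_span_iff[OF assms, of "vertices_of_ideal (span H)"]
  by (simp add: ideal_iff_subset_span_vertices hereditary_iff vertices_of_ideal_def)

lemma hereditary_vertices_of_ideal:
  assumes "ideal I"
  shows "hereditary assoc_graph (vertices_of_ideal I)"
  using assms unfolding ideal_iff_subset_span_vertices hereditary_iff
  by (auto simp: vertices_of_ideal_def)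

lemma ideal_span_vertices_of_ideal:
  assumes "ideal I"
  shows "ideal (span (vertices_of_ideal I))"
  using hereditary_vertices_of_ideal[OF assms]
  by (subst ideal_span_iff_hereditary) (auto simp: vertices_of_ideal_def)

section \<open>Maximal ideals and maximal hereditary sets\<close>

text \<open>
  \<open>span H\<^sub>I\<close> is an ideal above \<open>I\<close>. If it were the whole algebra, \<open>H\<^sub>I\<close> would be the whole basis
  and \<open>I\<close> would contain \<open>A\<^sup>2\<close>.
\<close>

lemma maximal_ideal_eq_span_vertices:
  assumes I: "maximal_ideal I" and sq: "\<not> square \<subseteq> I"
  shows "I = span (vertices_of_ideal I)"
proof -
  have id: "ideal I" using I by (simp add: maximal_ideal_def)
  have "vertices_of_ideal I \<noteq> B"
    using sq id square_subset_iff by (auto simp: ideal_def)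
  then have "span (vertices_of_ideal I) \<noteq> UNIV"
    by (subst span_eq_UNIV_iff) (auto simp: vertices_of_ideal_def)
  then show ?thesis
    using I id ideal_span_vertices_of_ideal ideal_iff_subset_span_vertices
    unfolding maximal_ideal_def by blast
qed

lemma maximal_hereditary_if_maximal_ideal_span:
  assumes H: "hereditary assoc_graph H" and max: "maximal_ideal (span H)"
  shows "maximal_hereditary assoc_graph H"
proof -
  have HB: "H \<subseteq> B" using H by (simp add: hereditary_def pverts_assoc_graph)
  have "H' = H \<or> H' = B" if H': "hereditary assoc_graph H'" "H \<subseteq> H'" for H'
  proof -
    have H'B: "H' \<subseteq> B" using H' by (simp add: hereditary_def pverts_assoc_graph)
    then have "ideal (span H')" using H' ideal_span_iff_hereditary by blast
    then have "span H' = span H \<or> span H' = UNIV"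
      using max H' span_mono unfolding maximal_ideal_def by blast
    then show ?thesis
      using span_subset_span_iff[OF H'B HB] span_eq_UNIV_iff[OF H'B] H'(2) by auto
  qed
  moreover have "H \<noteq> B" using max span_B by (auto simp: maximal_ideal_def)
  ultimately show ?thesis using H by (simp add: maximal_hereditary_def pverts_assoc_graph)
qed

text \<open>
  For an ideal \<open>J\<close> above \<open>span H\<close>, the hereditary set \<open>H\<^sub>J\<close> contains \<open>H\<close>. If \<open>H\<^sub>J = H\<close>, then
  \<open>J \<subseteq> span H\<^sub>J\<close> forces \<open>J = span H\<close>. If \<open>H\<^sub>J = B\<close>, then \<open>J\<close> contains \<open>A\<^sup>2\<close>, so it is one of the
  subspaces that the second hypothesis allows only to be the whole algebra.
\<close>

lemma maximal_ideal_span_if_maximal_hereditary: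
  assumes H: "maximal_hereditary assoc_graph H"
    and S: "\<And>S. subspace S \<Longrightarrow> square \<subseteq> S \<Longrightarrow> span H \<subseteq> S \<Longrightarrow> S = UNIV"
  shows "maximal_ideal (span H)"
proof -
  have her: "hereditary assoc_graph H" and ne: "H \<noteq> B"
    using H by (simp_all add: maximal_hereditary_def pverts_assoc_graph)
  have HB: "H \<subseteq> B" using her by (simp add: hereditary_def pverts_assoc_graph)
  have "J = span H \<or> J = UNIV" if J: "ideal J" "span H \<subseteq> J" for J
  proof -
    have sub: "subspace J" using J by (simp add: ideal_def)
    have "H \<subseteq> vertices_of_ideal J"
      using her J(2) unfolding hereditary_iff by (auto simp: vertices_of_ideal_def)
    then consider "vertices_of_ideal J = H" | "vertices_of_ideal J = B"
      using H hereditary_vertices_of_ideal[OF J(1)]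
      unfolding maximal_hereditary_def pverts_assoc_graph by blast
    then show ?thesis
    proof cases
      case 1
      then show ?thesis using J ideal_iff_subset_span_vertices by auto
    next
      case 2
      then show ?thesis using S sub J(2) square_subset_iff by blast
    qed
  qed
  then show ?thesis
    using her ne ideal_span_iff_hereditary[OF HB] span_eq_UNIV_iff[OF HB]
    by (simp add: maximal_ideal_def)
qed

end

theorem proposition3p9:
  fixes scale :: "'k::field \<Rightarrow> 'a::ab_group_add \<Rightarrow> 'a"
    and mult :: "'a \<Rightarrow> 'a \<Rightarrow> 'a" and B :: "'a set"
  assumes "evolution_algebra scale mult B"
  defines "E \<equiv> evolution_algebra.assoc_graph scale mult B"
  shows "(\<forall>I. nonassoc_algebra.ideal scale mult I \<and> nonassoc_algebra.square scale mult \<subseteq> I \<longrightarrow>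
            (nonassoc_algebra.maximal_ideal scale mult I \<longleftrightarrow> vector_space.has_codim scale I 1)) \<and>
         (\<forall>I. nonassoc_algebra.maximal_ideal scale mult I \<and>
              \<not> nonassoc_algebra.square scale mult \<subseteq> I \<longrightarrow>
            I = evolution_algebra.ideal_of_vertices scale
                  (evolution_algebra.vertices_of_ideal mult B I)) \<and>
         (\<forall>H. hereditary E H \<longrightarrow>
            (nonassoc_algebra.maximal_ideal scale mult
                (evolution_algebra.ideal_of_vertices scale H) \<longrightarrow> maximal_hereditary E H) \<and>
            (maximal_hereditary E H \<and>
               \<not> (\<exists>S. module.subspace scale S \<and> nonassoc_algebra.square scale mult \<subseteq> S \<and>
                      S \<noteq> UNIV \<and> evolution_algebra.ideal_of_vertices scale H \<subseteq> S) \<longrightarrow>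
             nonassoc_algebra.maximal_ideal scale mult
               (evolution_algebra.ideal_of_vertices scale H)))"
proof -
  interpret evolution_algebra scale mult B by (fact assms(1))
  show ?thesis
    unfolding E_def ideal_of_vertices_def
  proof (intro conjI allI impI; (elim conjE)?)
    fix I assume "ideal I" "square \<subseteq> I"
    then show "maximal_ideal I \<longleftrightarrow> has_codim I 1" by (rule maximal_ideal_iff_has_codim_1)
  next
    fix I assume "maximal_ideal I" "\<not> square \<subseteq> I"
    then show "I = span (vertices_of_ideal I)" by (rule maximal_ideal_eq_span_vertices)
  next
    fix H assume "hereditary assoc_graph H" "maximal_ideal (span H)"
    then show "maximal_hereditary assoc_graph H" by (rule maximal_hereditary_if_maximal_ideal_span)
  next
    fix H
    assume H: "maximal_hereditary assoc_graph H"
      and S: "\<not> (\<exists>S. subspace S \<and> square \<subseteq> S \<and> S \<noteq> UNIV \<and> span H \<subseteq> S)"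
    show "maximal_ideal (span H)"
      by (rule maximal_ideal_span_if_maximal_hereditary[OF H]) (use S in blast)
  qed
qed

end
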